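(* The RHA process is pseudo-asymptotically mean stationary: for every $m\ge1$ and every string $x_{1:m}$ the limit $\mu(x_{1:m})=\lim_{N\to\infty}\frac1N\sum_{i=1}^N P(X_{i:i+m-1}=x_{1:m})$ exists. Moreover, for all $n\ge0$ with $m\le 2^n$ and all $k\in\mathbb N$ ($k\ge1$), $$\mu(x_{1:m})=\frac{1}{2^n}\sum_{j=0}^{2^n-1}P\big(X_{k2^n+j:k2^n+j+m-1}=x_{1:m}\big).$$
   Context: Random hierarchical association (RHA) process. Fix positive integers $(k_n)_{n\ge0}$ (perplexities) with $k_{n-1}\le k_n\le k_{n-1}^2$ for all $n\ge1$. On a probability space $(\Omega,\mathcal J,P)$ let, for each $n\ge1$, $(L_{nj},R_{nj})_{j=1}^{k_n}$ be the lexicographically sorted enumeration of a uniformly random $k_n$-element subset of $\{1,\dots,k_{n-1}\}^2$ (each of the $\binom{k_{n-1}^2}{k_n}$ subsets equally likely), independently over $n$. Let $(C_n)_{n\ge0}$ be independent, independent of all $(L_{nj},R_{nj})$, with $C_n$ uniform on $\{1,\dots,k_n\}$. Define strings $Y^0_j=j$ (length 1) for $1\le j\le k_0$ and $Y^n_j=Y^{n-1}_{L_{nj}}Y^{n-1}_{R_{nj}}$ (concatenation) for $n\ge1$, $1\le j\le k_n$; so $Y^n_1,\dots,Y^n_{k_n}$ are distinct strings of length $2^n$ over $\{1,\dots,k_0\}$. The RHA process is the infinite sequence $\mathcal X=Y^0_{C_0}Y^1_{C_1}Y^2_{C_2}\cdots=X_1X_2X_3\cdots$ with $X_i\in\{1,\dots,k_0\}$,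 and $X_{k:l}=X_kX_{k+1}\cdots X_l$. *)

theory Defs
  imports "HOL-Probability.Probability"
begin

text \<open>Randomness of level n: the random subset S_n of {1..k(n-1)}^2 of size k n
  (level 0 carries no subset, we use the empty set) and the choice C_n uniform on {1..k n}.\<close>
definition rha_level :: "(nat \<Rightarrow> nat) \<Rightarrow> nat \<Rightarrow> ((nat \<times> nat) set \<times> nat) pmf" where
  "rha_level k n = pair_pmf
     (if n = 0 then return_pmf {}
      else pmf_of_set {S. S \<subseteq> {1..k (n - 1)} \<times> {1..k (n - 1)} \<and> card S = k n})
     (pmf_of_set {1..k n})"

definition rha_space :: "(nat \<Rightarrow> nat) \<Rightarrow> (nat \<Rightarrow> (nat \<times> nat) set \<times> nat) measure" where
  "rha_space k = (\<Pi>\<^sub>M n\<in>UNIV. measure_pmf (rha_level k n))"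

text \<open>(L_nj, R_nj) is the j-th (1-based) element of the lexicographically sorted subset S_n;
  Y^n_j as a list.\<close>
definition lex_less :: "nat \<times> nat \<Rightarrow> nat \<times> nat \<Rightarrow> bool" where
  "lex_less p q \<longleftrightarrow> fst p < fst q \<or> (fst p = fst q \<and> snd p < snd q)"

definition lex_nth :: "(nat \<times> nat) set \<Rightarrow> nat \<Rightarrow> nat \<times> nat" where
  "lex_nth S j = (THE p. p \<in> S \<and> card {q \<in> S. lex_less q p} = j - 1)"

fun rha_Y :: "(nat \<Rightarrow> (nat \<times> nat) set) \<Rightarrow> nat \<Rightarrow> nat \<Rightarrow> nat list" where
  "rha_Y S 0 j = [j]"
| "rha_Y S (Suc n) j =
     (let p = lex_nth (S (Suc n)) j
      in rha_Y S n (fst p) @ rha_Y S n (snd p))"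

text \<open>X_i (1-based): the i-th symbol of Y^0_{C_0} Y^1_{C_1} ...; the first Suc i blocks have
  total length 2^(Suc i) - 1 \<ge> i, so they suffice.\<close>
definition rha_X :: "(nat \<Rightarrow> (nat \<times> nat) set \<times> nat) \<Rightarrow> nat \<Rightarrow> nat" where
  "rha_X \<omega> i = concat (map (\<lambda>n. rha_Y (\<lambda>l. fst (\<omega> l)) n (snd (\<omega> n))) [0..<Suc i]) ! (i - 1)"

definition rha_prob :: "(nat \<Rightarrow> nat) \<Rightarrow> nat \<Rightarrow> nat list \<Rightarrow> real" where
  "rha_prob k i x = measure (rha_space k)
     {\<omega> \<in> space (rha_space k). map (rha_X \<omega>) [i..<i + length x] = x}"

end

theory Submission
  imports Defs
begin

text \<open>
  Block \<open>Y\<^sup>n\<close> of the process occupies the positions \<open>2\<^sup>n, \<dots>, 2\<^sup>n\<^sup>+\<^sup>1 - 1\<close>, so for \<open>c \<ge> 1\<close> the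
  \<open>2\<^sup>n\<close> symbols from position \<open>c 2\<^sup>n\<close> on form a string \<open>Y\<^sup>n\<^sub>J\<close> whose index \<open>J = J n c\<close> is found by
  descending the tree of pairs \<open>(L, R)\<close>. For every \<open>c \<ge> 1\<close> the two indices \<open>J n c\<close>, \<open>J n (c + 1)\<close> are
  independent, uniform, and independent of the subsets of the levels up to \<open>n\<close>, which alone
  determine the strings \<open>Y\<^sup>n\<^sub>j\<close>. A window of length at most \<open>2\<^sup>n\<close> meets at most two such blocks,
  hence the probability of seeing \<open>x\<close> at position \<open>i \<ge> 2\<^sup>n\<close> is periodic in \<open>i\<close> with period \<open>2\<^sup>n\<close>,
  and the Cesaro means converge to the mean over a period.

  The law of the two indices follows by induction on \<open>c\<close>. For even \<open>c\<close> they are the two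
  coordinates of one random element of the random subset of level \<open>n + 1\<close>; for odd \<open>c \<ge> 3\<close> they
  are the right coordinate of one element and the left coordinate of another one, drawn
  independently of the first (so possibly equal to it). The uniform law on subsets of a square
  \<open>A \<times> A\<close> of given size is invariant under \<open>\<pi> \<times> \<rho>\<close> for all permutations \<open>\<pi>\<close>, \<open>\<rho>\<close> of \<open>A\<close>,
  so the law of the two indices is invariant under all these maps as well, which forces it to be
  uniform.
\<close>

section \<open>Enumeration of a finite set in lexicographic order\<close>

lemma lex_less_linear:
  "\<not> lex_less p p"
  "lex_less p q \<Longrightarrow> lex_less q r \<Longrightarrow> lex_less p r"
  "p \<noteq> q \<Longrightarrow> lex_less p q \<or> lex_less q p"
  by (auto simp: lex_less_def prod_eq_iff)

text \<open>The rank strictly increases along \<open>lex_less\<close>, so it is injective, and it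
  stays below \<open>card S\<close>; counting gives surjectivity.\<close>

lemma bij_betw_lex_rank:
  assumes "finite S"
  shows "bij_betw (\<lambda>p. card {q \<in> S. lex_less q p}) S {..<card S}"
proof -
  let ?r = "\<lambda>p. card {q \<in> S. lex_less q p}"
  have less: "?r p < ?r q" if "p \<in> S" "lex_less p q" for p q
  proof (rule psubset_card_mono)
    show "finite {s \<in> S. lex_less s q}" using assms by simp
    have "{s \<in> S. lex_less s p} \<subseteq> {s \<in> S. lex_less s q}"
      using lex_less_linear(2)[OF _ that(2)] by blast
    moreover have "p \<in> {s \<in> S. lex_less s q} - {s \<in> S. lex_less s p}"
      using that lex_less_linear(1) by simp
    ultimately show "{s \<in> S. lex_less s p} \<subset> {s \<in> S. lex_less s q}"
      by blast
  qed
  have inj: "inj_on ?r S"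
  proof (rule inj_onI, rule ccontr)
    fix p q assume pq: "p \<in> S" "q \<in> S" "?r p = ?r q" "p \<noteq> q"
    then show False
      using lex_less_linear(3)[of p q] less[of p q] less[of q p] by linarith
  qed
  have "?r ` S \<subseteq> {..<card S}"
  proof (rule image_subsetI)
    fix p assume "p \<in> S"
    then have "{q \<in> S. lex_less q p} \<subset> S"
      using lex_less_linear(1)[of p] by blast
    then show "?r p \<in> {..<card S}"
      using psubset_card_mono[OF assms] by simp
  qed
  moreover have "card (?r ` S) = card {..<card S}"
    using card_image[OF inj] by simp
  ultimately show ?thesis
    unfolding bij_betw_def using inj card_subset_eq[OF finite_lessThan] by blast
qed

lemma bij_betw_lex_nth:
  assumes "finite S"
  shows "bij_betw (lex_nth S) {1..card S} S"
proof -
  let ?r = "\<lambda>p. card {q \<in> S. lex_less q p}"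
  have bij: "bij_betw ?r S {..<card S}"
    by (rule bij_betw_lex_rank[OF assms])
  \<comment> \<open>\<open>the_inv_into\<close> unfolds to the very \<open>THE\<close> term that
    defines \<open>lex_nth\<close>.\<close>
  have nth: "lex_nth S j = the_inv_into S ?r (j - 1)" if "j \<in> {1..card S}" for j
    by (simp add: lex_nth_def the_inv_into_def)
  have "bij_betw (\<lambda>j. j - 1) {1..card S} {..<card S}"
    by (rule bij_betw_byWitness[where f' = Suc]) auto
  then have "bij_betw (the_inv_into S ?r \<circ> (\<lambda>j. j - 1)) {1..card S} S"
    by (rule bij_betw_trans[OF _ bij_betw_the_inv_into[OF bij]])
  then show ?thesis
    by (rule bij_betw_cong[THEN iffD1, rotated]) (simp add: nth)
qed

text \<open>This replaces a uniform index into the sorted list by a uniform element of the set,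
  which frees the laws from the order of enumeration.\<close>

lemma map_lex_nth_pmf:
  assumes "finite S" "S \<noteq> {}"
  shows "map_pmf (lex_nth S) (pmf_of_set {1..card S}) = pmf_of_set S"
  using assms
  by (intro map_pmf_of_set_bij_betw bij_betw_lex_nth) (auto simp: Suc_le_eq card_gt_0_iff)

section \<open>Uniformly random subsets of a square\<close>

abbreviation subsets_of_card :: "'a set \<Rightarrow> nat \<Rightarrow> 'a set set" where
  "subsets_of_card B k \<equiv> {T. T \<subseteq> B \<and> card T = k}"

lemma subsets_of_card_finite: "finite B \<Longrightarrow> finite (subsets_of_card B k)"
  by (rule finite_subset[of _ "Pow B"]) auto

lemma subsets_of_card_nonempty: "k \<le> card B \<Longrightarrow> subsets_of_card B k \<noteq> {}"
  using obtain_subset_with_card_n by blast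

text \<open>A bijection of \<open>B\<close> acts injectively on the finite family of
  \<open>k\<close>-element subsets, hence permutes it.\<close>

lemma map_image_random_subset:
  assumes "finite B" "k \<le> card B" "bij_betw h B B"
  shows "map_pmf ((`) h) (pmf_of_set (subsets_of_card B k)) = pmf_of_set (subsets_of_card B k)"
proof (rule map_pmf_of_set_bij_betw)
  have inj: "inj_on h B" and img: "h ` B = B"
    using assms(3) by (auto simp: bij_betw_def)
  have "inj_on ((`) h) (subsets_of_card B k)"
    using inj by (intro inj_onI) (metis (no_types, lifting) inj_on_image_eq_iff mem_Collect_eq)
  moreover have "(`) h ` subsets_of_card B k \<subseteq> subsets_of_card B k"
    using inj img by (auto simp: card_image inj_on_subset)
  ultimately show "bij_betw ((`) h) (subsets_of_card B k) (subsets_of_card B k)"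
    unfolding bij_betw_def using endo_inj_surj subsets_of_card_finite[OF assms(1)] by blast
qed (use assms subsets_of_card_finite subsets_of_card_nonempty in blast)+

lemma pmf_uniformI:
  assumes "finite A" "A \<noteq> {}" "set_pmf M \<subseteq> A"
    and const: "\<And>x y. x \<in> A \<Longrightarrow> y \<in> A \<Longrightarrow> pmf M x = pmf M y"
  shows "M = pmf_of_set A"
proof -
  obtain a where a: "a \<in> A" using assms(2) by blast
  have "1 = (\<Sum>x\<in>A. pmf M x)"
    by (rule sum_pmf_eq_1[symmetric, OF assms(1,3)])
  also have "\<dots> = (\<Sum>x\<in>A. pmf M a)"
    by (intro sum.cong refl const a)
  finally have "pmf M a = 1 / card A"
    using assms(1,2) by (simp add: field_simps)
  then have "pmf M x = pmf (pmf_of_set A) x" for x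
    using assms(1-3) const[OF _ a, of x]
    by (cases "x \<in> A") (auto simp: set_pmf_iff)
  then show ?thesis by (rule pmf_eqI)
qed

lemma pair_pmf_of_set:
  assumes "finite A" "A \<noteq> {}" "finite B" "B \<noteq> {}"
  shows "pair_pmf (pmf_of_set A) (pmf_of_set B) = pmf_of_set (A \<times> B)"
proof (rule pmf_uniformI)
  show "pmf (pair_pmf (pmf_of_set A) (pmf_of_set B)) x =
      pmf (pair_pmf (pmf_of_set A) (pmf_of_set B)) y" if "x \<in> A \<times> B" "y \<in> A \<times> B" for x y
    using that by (cases x; cases y)
      (simp add: pmf_pair pmf_of_set[OF assms(2,1)] pmf_of_set[OF assms(4,3)])
qed (use assms in auto)

text \<open>One transposition per coordinate carries any point of \<open>A \<times> A\<close> to any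
  other, so all masses agree. The two permutations must be chosen separately: equal ones never move
  a point off the diagonal.\<close>

lemma permutation_invariant_pmf:
  assumes "finite A" "A \<noteq> {}" "set_pmf M \<subseteq> A \<times> A"
    and inv: "\<And>\<pi> \<rho>. \<pi> permutes A \<Longrightarrow> \<rho> permutes A \<Longrightarrow> map_pmf (map_prod \<pi> \<rho>) M = M"
  shows "M = pair_pmf (pmf_of_set A) (pmf_of_set A)"
proof -
  have "M = pmf_of_set (A \<times> A)"
  proof (rule pmf_uniformI)
    fix x y assume xy: "x \<in> A \<times> A" "y \<in> A \<times> A"
    define \<pi> where "\<pi> = Transposition.transpose (fst x) (fst y)"
    define \<rho> where "\<rho> = Transposition.transpose (snd x) (snd y)"
    have perm: "\<pi> permutes A" "\<rho> permutes A"
      using xy by (auto simp: \<pi>_def \<rho>_def intro!: permutes_swap_id)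
    then have "inj (map_prod \<pi> \<rho>)"
      by (intro prod.inj_map permutes_inj)
    moreover have "map_prod \<pi> \<rho> x = y"
      by (simp add: \<pi>_def \<rho>_def prod_eq_iff)
    ultimately show "pmf M x = pmf M y"
      using pmf_map_inj'[of "map_prod \<pi> \<rho>" M x] inv[OF perm] by simp
  qed (use assms in auto)
  then show ?thesis
    by (simp only: pair_pmf_of_set[OF assms(1,2,1,2)])
qed

lemma bij_betw_map_prod_permutes:
  assumes "\<pi> permutes A" "\<rho> permutes A"
  shows "bij_betw (map_prod \<pi> \<rho>) (A \<times> A) (A \<times> A)"
  using assms by (intro bij_betw_map_prod permutes_imp_bij)

lemma set_pmf_random_subset:
  assumes "finite B" "k \<le> card B" "0 < k" "T \<in> set_pmf (pmf_of_set (subsets_of_card B k))"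
  shows "T \<subseteq> B" "card T = k" "finite T" "T \<noteq> {}"
proof -
  have "T \<in> subsets_of_card B k"
    using assms(4)
    unfolding set_pmf_of_set[OF subsets_of_card_nonempty[OF assms(2)] subsets_of_card_finite[OF assms(1)]] .
  then show "T \<subseteq> B" "card T = k" "finite T" "T \<noteq> {}"
    using assms(1,3) by (auto intro: finite_subset)
qed

text \<open>Law of the two halves of one parent. Relabelling the coordinates turns a uniform point
  of \<open>T\<close> into a uniform point of the image of \<open>T\<close>, and that image is again
  a uniformly random subset.\<close>

lemma random_subset_sibling_law:
  assumes "finite A" "0 < k" "k \<le> card A ^ 2"
  shows "pmf_of_set (subsets_of_card (A \<times> A) k) \<bind> (\<lambda>T. pmf_of_set T) =
    pair_pmf (pmf_of_set A) (pmf_of_set A)" (is "?M = _")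
proof (rule permutation_invariant_pmf)
  let ?R = "pmf_of_set (subsets_of_card (A \<times> A) k)"
  have R: "finite (A \<times> A)" "k \<le> card (A \<times> A)"
    using assms by (auto simp: power2_eq_square card_cartesian_product)
  note T = set_pmf_random_subset[OF R assms(2)]
  show "A \<noteq> {}" using assms by auto
  have supp: "set_pmf (pmf_of_set T) \<subseteq> A \<times> A" if "T \<in> set_pmf ?R" for T
    using T[OF that] by simp
  show "set_pmf ?M \<subseteq> A \<times> A"
    unfolding set_bind_pmf using supp by blast
  fix \<pi> \<rho> assume "\<pi> permutes A" "\<rho> permutes A"
  then have bij: "bij_betw (map_prod \<pi> \<rho>) (A \<times> A) (A \<times> A)"
    by (rule bij_betw_map_prod_permutes)
  have img: "map_pmf (map_prod \<pi> \<rho>) (pmf_of_set T) = pmf_of_set (map_prod \<pi> \<rho> ` T)"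
    if "T \<in> set_pmf ?R" for T
    by (intro map_pmf_of_set_inj inj_on_subset[OF bij_betw_imp_inj_on[OF bij]] T[OF that])
  have "map_pmf (map_prod \<pi> \<rho>) ?M = ?R \<bind> (\<lambda>T. pmf_of_set (map_prod \<pi> \<rho> ` T))"
    unfolding map_bind_pmf by (intro bind_pmf_cong refl img)
  also have "\<dots> = map_pmf ((`) (map_prod \<pi> \<rho>)) ?R \<bind> (\<lambda>T. pmf_of_set T)"
    by (simp add: bind_map_pmf)
  finally show "map_pmf (map_prod \<pi> \<rho>) ?M = ?M"
    by (simp only: map_image_random_subset[OF R bij])
qed fact

text \<open>Law of two adjacent halves of neighbouring parents. Both points come from the same
  \<open>T\<close>, so their independence given \<open>T\<close> is not enough; the invariance of
  the averaged law is what decides.\<close>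

lemma random_subset_cousin_law:
  assumes "finite A" "0 < k" "k \<le> card A ^ 2"
  shows "pmf_of_set (subsets_of_card (A \<times> A) k) \<bind>
      (\<lambda>T. map_pmf (\<lambda>(p, q). (snd p, fst q)) (pair_pmf (pmf_of_set T) (pmf_of_set T))) =
    pair_pmf (pmf_of_set A) (pmf_of_set A)" (is "?M = _")
proof (rule permutation_invariant_pmf)
  let ?R = "pmf_of_set (subsets_of_card (A \<times> A) k)"
  let ?g = "\<lambda>(p, q). (snd p, fst q)"
  have R: "finite (A \<times> A)" "k \<le> card (A \<times> A)"
    using assms by (auto simp: power2_eq_square card_cartesian_product)
  note T = set_pmf_random_subset[OF R assms(2)]
  show "A \<noteq> {}" using assms by auto
  have supp: "set_pmf (pmf_of_set T) \<subseteq> A \<times> A" if "T \<in> set_pmf ?R" for T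
    using T[OF that] by simp
  show "set_pmf ?M \<subseteq> A \<times> A"
    unfolding set_bind_pmf set_map_pmf set_pair_pmf using supp by fastforce
  \<comment> \<open>The first output is a right coordinate and the second a left one, so
    \<open>map_prod \<rho> \<pi>\<close> on the outputs is induced by
    \<open>map_prod \<pi> \<rho>\<close> on the square.\<close>
  fix \<rho> \<pi> assume "\<rho> permutes A" "\<pi> permutes A"
  then have bij: "bij_betw (map_prod \<pi> \<rho>) (A \<times> A) (A \<times> A)"
    by (intro bij_betw_map_prod_permutes)
  have img: "map_pmf (map_prod \<pi> \<rho>) (pmf_of_set T) = pmf_of_set (map_prod \<pi> \<rho> ` T)"
    if "T \<in> set_pmf ?R" for T
    by (intro map_pmf_of_set_inj inj_on_subset[OF bij_betw_imp_inj_on[OF bij]] T[OF that])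
  have swap: "map_pmf (map_prod \<rho> \<pi>) (map_pmf ?g (pair_pmf P P)) =
      map_pmf ?g (pair_pmf (map_pmf (map_prod \<pi> \<rho>) P) (map_pmf (map_prod \<pi> \<rho>) P))" for P
    unfolding map_pair[symmetric] pmf.map_comp by (simp add: o_def case_prod_beta)
  have "map_pmf (map_prod \<rho> \<pi>) ?M = ?R \<bind> (\<lambda>T. map_pmf ?g
      (pair_pmf (pmf_of_set (map_prod \<pi> \<rho> ` T)) (pmf_of_set (map_prod \<pi> \<rho> ` T))))"
    unfolding map_bind_pmf swap by (intro bind_pmf_cong refl) (simp only: img)
  also have "\<dots> = map_pmf ((`) (map_prod \<pi> \<rho>)) ?R \<bind>
      (\<lambda>T. map_pmf ?g (pair_pmf (pmf_of_set T) (pmf_of_set T)))"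
    by (simp add: bind_map_pmf)
  finally show "map_pmf (map_prod \<rho> \<pi>) ?M = ?M"
    by (simp only: map_image_random_subset[OF R bij])
qed fact

section \<open>Blocks\<close>

lemma length_rha_Y [simp]: "length (rha_Y S n j) = 2 ^ n"
  by (induction n arbitrary: j) (auto simp: Let_def)

lemma rha_Y_cong:
  "(\<And>l. l \<le> n \<Longrightarrow> S l = S' l) \<Longrightarrow> rha_Y S n j = rha_Y S' n j"
  by (induction n arbitrary: j) (auto simp: Let_def)

lemma rha_X_cong:
  assumes "\<And>l. l \<le> i \<Longrightarrow> \<omega> l = \<omega>' l"
  shows "rha_X \<omega> i = rha_X \<omega>' i"
proof -
  have "map (\<lambda>n. rha_Y (\<lambda>l. fst (\<omega> l)) n (snd (\<omega> n))) [0..<Suc i] =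
        map (\<lambda>n. rha_Y (\<lambda>l. fst (\<omega>' l)) n (snd (\<omega>' n))) [0..<Suc i]"
    using assms by (intro map_cong refl) (auto intro!: rha_Y_cong arg_cong2[where f = "\<lambda>a b. rha_Y _ a b"])
  then show ?thesis by (simp only: rha_X_def)
qed

lemma length_concat_rha_Y:
  "length (concat (map (\<lambda>l. rha_Y S l (C l)) [0..<n])) = 2 ^ n - 1"
  by (induction n) auto

text \<open>The earlier blocks fill \<open>2 ^ n - 1\<close> positions, so with positions counted
  from 1 block \<open>n\<close> starts exactly at \<open>2 ^ n\<close>.\<close>

lemma rha_X_first_block:
  assumes "j < 2 ^ n"
  shows "rha_X \<omega> (2 ^ n + j) = rha_Y (\<lambda>l. fst (\<omega> l)) n (snd (\<omega> n)) ! j"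
proof -
  let ?Y = "\<lambda>l. rha_Y (\<lambda>l. fst (\<omega> l)) l (snd (\<omega> l))"
  have n: "n < Suc (2 ^ n + j)"
    using less_exp[of n] by linarith
  then have "[0..<Suc (2 ^ n + j)] = [0..<n] @ n # [Suc n..<Suc (2 ^ n + j)]"
    by (metis le0 less_imp_le_nat upt_add_eq_append upt_conv_Cons le_add_diff_inverse)
  then have "rha_X \<omega> (2 ^ n + j) =
      (concat (map ?Y [0..<n]) @ ?Y n @ concat (map ?Y [Suc n..<Suc (2 ^ n + j)])) ! (2 ^ n - 1 + j)"
    unfolding rha_X_def by (simp del: upt_Suc)
  moreover have "\<not> 2 ^ n - 1 + j < length (concat (map ?Y [0..<n]))"
    by (simp add: length_concat_rha_Y)
  ultimately show ?thesis
    using assms by (simp only: nth_append length_concat_rha_Y length_rha_Y if_True if_False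
        add_diff_cancel_left')
qed

text \<open>This is the index \<open>J n c\<close>. The \<open>c\<close>-th aligned stretch of
  length \<open>2 ^ n\<close> is a half of stretch \<open>c div 2\<close> one level higher, until
  stretch 1 is reached, whose index is the random choice of its level. The case \<open>c = 0\<close>
  has a dummy value to make the recursion terminate.\<close>

function block :: "(nat \<Rightarrow> (nat \<times> nat) set \<times> nat) \<Rightarrow> nat \<Rightarrow> nat \<Rightarrow> nat" where
  "block \<omega> n c =
     (if c \<le> 1 then snd (\<omega> n)
      else let p = lex_nth (fst (\<omega> (Suc n))) (block \<omega> (Suc n) (c div 2))
           in if even c then fst p else snd p)"
  by auto
termination by (relation "Wellfounded.measure (\<lambda>(\<omega>, n, c). c)") auto

declare block.simps [simp del]

lemma rha_X_block:
  assumes "1 \<le> c" "j < 2 ^ n"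
  shows "rha_X \<omega> (c * 2 ^ n + j) = rha_Y (\<lambda>l. fst (\<omega> l)) n (block \<omega> n c) ! j"
  using assms
proof (induction c arbitrary: n j rule: less_induct)
  case (less c)
  show ?case
  proof (cases "c = 1")
    case True
    then show ?thesis
      using less.prems rha_X_first_block by (simp add: block.simps)
  next
    case False
    \<comment> \<open>The offset inside the parent block: odd \<open>c\<close> is its right
      half.\<close>
    let ?r = "(c mod 2) * 2 ^ n + j"
    have "c * 2 ^ n = (c div 2 * 2 + c mod 2) * 2 ^ n"
      by simp
    also have "\<dots> = c div 2 * 2 ^ Suc n + (c mod 2) * 2 ^ n"
      by (simp only: add_mult_distrib power_Suc mult.assoc)
    finally have eq: "c * 2 ^ n + j = c div 2 * 2 ^ Suc n + ?r"
      by simp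
    have "?r < 2 ^ Suc n"
      using less.prems by (cases "even c") (auto simp: odd_iff_mod_2_eq_one)
    then have "rha_X \<omega> (c * 2 ^ n + j) =
        rha_Y (\<lambda>l. fst (\<omega> l)) (Suc n) (block \<omega> (Suc n) (c div 2)) ! ?r"
      unfolding eq using False less.prems by (intro less.IH) auto
    then show ?thesis
      using False less.prems
      by (cases "even c")
         (auto simp: block.simps[of \<omega> n c] Let_def nth_append odd_iff_mod_2_eq_one)
  qed
qed

lemma rha_X_window:
  assumes "1 \<le> c" "j < 2 ^ n" "m \<le> 2 ^ n"
  shows "map (rha_X \<omega>) [c * 2 ^ n + j..<c * 2 ^ n + j + m] =
    map ((!) (rha_Y (\<lambda>l. fst (\<omega> l)) n (block \<omega> n c) @ rha_Y (\<lambda>l. fst (\<omega> l)) n (block \<omega> n (Suc c))))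
      [j..<j + m]"
proof (rule nth_equalityI)
  fix t assume "t < length (map (rha_X \<omega>) [c * 2 ^ n + j..<c * 2 ^ n + j + m])"
  then have t: "t < m" by simp
  have "rha_X \<omega> (c * 2 ^ n + j + t) =
    (rha_Y (\<lambda>l. fst (\<omega> l)) n (block \<omega> n c) @ rha_Y (\<lambda>l. fst (\<omega> l)) n (block \<omega> n (Suc c))) ! (j + t)"
  proof (cases "j + t < 2 ^ n")
    case True
    then show ?thesis
      using rha_X_block[OF assms(1) True] by (simp add: nth_append add.assoc)
  next
    case False
    then have eq: "c * 2 ^ n + j + t = Suc c * 2 ^ n + (j + t - 2 ^ n)" and "j + t - 2 ^ n < 2 ^ n"
      using t assms by auto
    then show ?thesis
      unfolding eq using False by (subst rha_X_block) (auto simp: nth_append)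
  qed
  then show "map (rha_X \<omega>) [c * 2 ^ n + j..<c * 2 ^ n + j + m] ! t =
    map ((!) (rha_Y (\<lambda>l. fst (\<omega> l)) n (block \<omega> n c) @ rha_Y (\<lambda>l. fst (\<omega> l)) n (block \<omega> n (Suc c))))
      [j..<j + m] ! t"
    using t by simp
qed simp

section \<open>The joint law of two consecutive blocks\<close>

definition subset_pmf :: "(nat \<Rightarrow> nat) \<Rightarrow> nat \<Rightarrow> (nat \<times> nat) set pmf" where
  "subset_pmf k n = map_pmf fst (rha_level k n)"

abbreviation index_pmf :: "(nat \<Rightarrow> nat) \<Rightarrow> nat \<Rightarrow> nat pmf" where
  "index_pmf k n \<equiv> pmf_of_set {1..k n}"

lemma rha_level_eq: "rha_level k n = pair_pmf (subset_pmf k n) (index_pmf k n)"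
  by (simp add: rha_level_def subset_pmf_def map_fst_pair_pmf)

lemma subset_pmf_Suc:
  "subset_pmf k (Suc n) = pmf_of_set (subsets_of_card ({1..k n} \<times> {1..k n}) (k (Suc n)))"
  by (simp add: rha_level_def subset_pmf_def map_fst_pair_pmf)

definition past_pmf :: "(nat \<Rightarrow> nat) \<Rightarrow> nat \<Rightarrow> (nat \<Rightarrow> (nat \<times> nat) set) pmf" where
  "past_pmf k n = Pi_pmf {..n} {} (subset_pmf k)"

text \<open>The default \<open>{}\<close> matches the one in \<open>past_pmf\<close>, so that the
  two laws can be equal as laws of total functions.\<close>

definition past :: "nat \<Rightarrow> (nat \<Rightarrow> (nat \<times> nat) set \<times> nat) \<Rightarrow> nat \<Rightarrow> (nat \<times> nat) set" where
  "past n \<omega> = (\<lambda>l. if l \<le> n then fst (\<omega> l) else {})"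

text \<open>A discrete stand-in for \<open>rha_space\<close>, in which laws are computed by monadic
  rewriting; \<open>rha_prob_eq_finite\<close> transfers them.\<close>

definition finite_rha_pmf :: "(nat \<Rightarrow> nat) \<Rightarrow> nat \<Rightarrow> (nat \<Rightarrow> (nat \<times> nat) set \<times> nat) pmf" where
  "finite_rha_pmf k N = Pi_pmf {..N} ({}, 0) (rha_level k)"

lemma past_pmf_Suc:
  "past_pmf k (Suc n) =
     do {T \<leftarrow> subset_pmf k (Suc n); S \<leftarrow> past_pmf k n; return_pmf (S(Suc n := T))}"
  by (simp add: past_pmf_def atMost_Suc Pi_pmf_insert')

lemma bind_pmf_reverse3:
  "do {a \<leftarrow> A; b \<leftarrow> B; c \<leftarrow> C; f a b c} = do {c \<leftarrow> C; b \<leftarrow> B; a \<leftarrow> A; (f a b c :: 'd pmf)}"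
proof -
  have "do {a \<leftarrow> A; b \<leftarrow> B; c \<leftarrow> C; f a b c} = do {a \<leftarrow> A; c \<leftarrow> C; b \<leftarrow> B; f a b c}"
    by (intro bind_pmf_cong refl bind_commute_pmf)
  also have "\<dots> = do {c \<leftarrow> C; a \<leftarrow> A; b \<leftarrow> B; f a b c}"
    by (rule bind_commute_pmf)
  also have "\<dots> = do {c \<leftarrow> C; b \<leftarrow> B; a \<leftarrow> A; f a b c}"
    by (intro bind_pmf_cong refl bind_commute_pmf)
  finally show ?thesis .
qed

text \<open>Induction step in abstract form: if \<open>U\<close> is independent of the subsets up to
  level \<open>n + 1\<close>, then whatever is computed from \<open>U\<close> and the top subset is
  independent of the lower ones. Updating with \<open>{}\<close> forgets the top level.\<close>

lemma past_pmf_step: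
  "map_pmf (\<lambda>(S, u). (S(Suc n := {}), h (S (Suc n)) u)) (pair_pmf (past_pmf k (Suc n)) U) =
   pair_pmf (past_pmf k n) (do {T \<leftarrow> subset_pmf k (Suc n); map_pmf (h T) U})"
proof -
  have S: "S(Suc n := {}) = S" if "S \<in> set_pmf (past_pmf k n)" for S
    using that set_Pi_pmf_subset[of "{..n}" "{}" "subset_pmf k"] by (auto simp: past_pmf_def fun_eq_iff)
  have "map_pmf (\<lambda>(S, u). (S(Suc n := {}), h (S (Suc n)) u)) (pair_pmf (past_pmf k (Suc n)) U) =
    do {T \<leftarrow> subset_pmf k (Suc n); S \<leftarrow> past_pmf k n; u \<leftarrow> U; return_pmf (S(Suc n := {}), h T u)}"
    by (simp add: past_pmf_Suc pair_pmf_def map_pmf_def bind_assoc_pmf bind_return_pmf)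
  also have "\<dots> =
    do {S \<leftarrow> past_pmf k n; T \<leftarrow> subset_pmf k (Suc n); u \<leftarrow> U; return_pmf (S(Suc n := {}), h T u)}"
    by (rule bind_commute_pmf)
  also have "\<dots> =
    do {S \<leftarrow> past_pmf k n; T \<leftarrow> subset_pmf k (Suc n); u \<leftarrow> U; return_pmf (S, h T u)}"
    by (intro bind_pmf_cong refl) (simp only: S)
  also have "\<dots> = pair_pmf (past_pmf k n) (do {T \<leftarrow> subset_pmf k (Suc n); map_pmf (h T) U})"
    by (simp add: pair_pmf_def map_pmf_def bind_assoc_pmf bind_return_pmf)
  finally show ?thesis .
qed

lemma map_finite_rha_pmf_mono:
  assumes "M \<le> N" and "\<And>\<omega> \<omega>'. (\<And>l. l \<le> M \<Longrightarrow> \<omega> l = \<omega>' l) \<Longrightarrow> f \<omega> = f \<omega>'"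
  shows "map_pmf f (finite_rha_pmf k N) = map_pmf f (finite_rha_pmf k M)"
proof -
  have "finite_rha_pmf k M =
      map_pmf (\<lambda>\<omega> l. if l \<in> {..M} then \<omega> l else ({}, 0)) (finite_rha_pmf k N)"
    unfolding finite_rha_pmf_def using assms(1) by (intro Pi_pmf_subset) auto
  then show ?thesis
    by (auto simp: pmf.map_comp o_def intro!: map_pmf_cong assms(2))
qed

context
  fixes k :: "nat \<Rightarrow> nat"
  assumes kpos: "\<And>n. 0 < k n"
    and kgrowth: "\<And>n. k (Suc n) \<le> (k n)\<^sup>2"
begin

lemma map_lex_nth_index_pmf:
  assumes "T \<in> set_pmf (subset_pmf k (Suc n))"
  shows "map_pmf (lex_nth T) (index_pmf k (Suc n)) = pmf_of_set T"
proof -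
  have "finite ({1..k n} \<times> {1..k n})" "k (Suc n) \<le> card ({1..k n} \<times> {1..k n})"
    using kgrowth[of n] by (auto simp: card_cartesian_product power2_eq_square)
  from set_pmf_random_subset[OF this kpos assms[unfolded subset_pmf_Suc]]
  show ?thesis using map_lex_nth_pmf by metis
qed

lemma sibling_law:
  "do {T \<leftarrow> subset_pmf k (Suc n); map_pmf (lex_nth T) (index_pmf k (Suc n))} =
   pair_pmf (index_pmf k n) (index_pmf k n)"
proof -
  have "do {T \<leftarrow> subset_pmf k (Suc n); map_pmf (lex_nth T) (index_pmf k (Suc n))} =
        do {T \<leftarrow> subset_pmf k (Suc n); pmf_of_set T}"
    by (intro bind_pmf_cong refl map_lex_nth_index_pmf)
  also have "\<dots> = pair_pmf (index_pmf k n) (index_pmf k n)"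
    unfolding subset_pmf_Suc using kpos kgrowth by (intro random_subset_sibling_law) auto
  finally show ?thesis .
qed

lemma cousin_law:
  "do {T \<leftarrow> subset_pmf k (Suc n);
       map_pmf (\<lambda>(a, b). (snd (lex_nth T a), fst (lex_nth T b)))
         (pair_pmf (index_pmf k (Suc n)) (index_pmf k (Suc n)))} =
   pair_pmf (index_pmf k n) (index_pmf k n)"
proof -
  have "map_pmf (\<lambda>(a, b). (snd (lex_nth T a), fst (lex_nth T b)))
         (pair_pmf (index_pmf k (Suc n)) (index_pmf k (Suc n))) =
        map_pmf (\<lambda>(p, q). (snd p, fst q)) (pair_pmf (pmf_of_set T) (pmf_of_set T))"
    if T: "T \<in> set_pmf (subset_pmf k (Suc n))" for T
    unfolding map_lex_nth_index_pmf[OF T, symmetric] map_pair[symmetric] pmf.map_comp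
    by (simp add: o_def case_prod_unfold)
  then have "do {T \<leftarrow> subset_pmf k (Suc n);
       map_pmf (\<lambda>(a, b). (snd (lex_nth T a), fst (lex_nth T b)))
         (pair_pmf (index_pmf k (Suc n)) (index_pmf k (Suc n)))} =
     do {T \<leftarrow> subset_pmf k (Suc n);
       map_pmf (\<lambda>(p, q). (snd p, fst q)) (pair_pmf (pmf_of_set T) (pmf_of_set T))}"
    by (intro bind_pmf_cong refl)
  also have "\<dots> = pair_pmf (index_pmf k n) (index_pmf k n)"
    unfolding subset_pmf_Suc using kpos kgrowth by (intro random_subset_cousin_law) auto
  finally show ?thesis .
qed

text \<open>The case \<open>c = 1\<close>: the choice at level \<open>n\<close> and the left half of
  the choice at level \<open>n + 1\<close>. The latter depends on level \<open>n + 1\<close> alone,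
  and its law is a marginal of \<open>sibling_law\<close>.\<close>

lemma first_blocks_law:
  "map_pmf (\<lambda>\<omega>. (past n \<omega>, snd (\<omega> n), fst (lex_nth (fst (\<omega> (Suc n))) (snd (\<omega> (Suc n))))))
      (finite_rha_pmf k (Suc n)) = pair_pmf (past_pmf k n) (pair_pmf (index_pmf k n) (index_pmf k n))"
    (is "map_pmf ?f _ = _")
proof -
  let ?Q = "Pi_pmf {..<n} ({}, 0) (rha_level k)"
  let ?B = "do {T' \<leftarrow> subset_pmf k (Suc n); C' \<leftarrow> index_pmf k (Suc n); return_pmf (fst (lex_nth T' C'))}"
  have "?B = map_pmf fst (do {T \<leftarrow> subset_pmf k (Suc n); map_pmf (lex_nth T) (index_pmf k (Suc n))})"
    by (simp add: map_pmf_def bind_assoc_pmf bind_return_pmf)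
  also have "\<dots> = index_pmf k n"
    by (simp only: sibling_law map_fst_pair_pmf)
  finally have B: "?B = index_pmf k n" .
  have past_eq: "past n (g(n := (T, C), Suc n := z)) = (fst \<circ> g)(n := T)"
    if "g \<in> set_pmf ?Q" for g T z C
    using that set_Pi_pmf_subset[of "{..<n}" "({}, 0)" "rha_level k"]
    by (auto simp: past_def fun_eq_iff)
  have past_pmf: "past_pmf k n =
      do {T \<leftarrow> subset_pmf k n; g \<leftarrow> ?Q; return_pmf ((fst \<circ> g)(n := T))}"
  proof -
    have "Pi_pmf {..<n} {} (subset_pmf k) = map_pmf (\<lambda>g. fst \<circ> g) ?Q"
      unfolding subset_pmf_def by (rule Pi_pmf_map) auto
    moreover have "{..n} = insert n {..<n}" by auto
    ultimately show ?thesis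
      by (simp add: past_pmf_def Pi_pmf_insert' bind_map_pmf)
  qed
  have level: "bind_pmf (rha_level k l) g = do {T \<leftarrow> subset_pmf k l; C \<leftarrow> index_pmf k l; g (T, C)}"
    for l and g :: "_ \<Rightarrow> 'z pmf"
    by (simp add: rha_level_eq pair_pmf_def bind_assoc_pmf bind_return_pmf)
  have "{..Suc n} = insert (Suc n) (insert n {..<n})" by auto
  then have "map_pmf ?f (finite_rha_pmf k (Suc n)) =
    do {T' \<leftarrow> subset_pmf k (Suc n); C' \<leftarrow> index_pmf k (Suc n);
        T \<leftarrow> subset_pmf k n; C \<leftarrow> index_pmf k n; g \<leftarrow> ?Q;
        return_pmf (past n (g(n := (T, C), Suc n := (T', C'))), C, fst (lex_nth T' C'))}"
    by (simp add: finite_rha_pmf_def Pi_pmf_insert' map_bind_pmf level bind_assoc_pmf bind_return_pmf)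
  also have "\<dots> =
    do {T' \<leftarrow> subset_pmf k (Suc n); C' \<leftarrow> index_pmf k (Suc n);
        T \<leftarrow> subset_pmf k n; C \<leftarrow> index_pmf k n; g \<leftarrow> ?Q;
        return_pmf ((fst \<circ> g)(n := T), C, fst (lex_nth T' C'))}"
    by (intro bind_pmf_cong refl) (simp only: past_eq)
  also have "\<dots> =
    do {b \<leftarrow> ?B; T \<leftarrow> subset_pmf k n; C \<leftarrow> index_pmf k n; g \<leftarrow> ?Q;
        return_pmf ((fst \<circ> g)(n := T), C, b)}"
    by (simp add: bind_assoc_pmf bind_return_pmf)
  also have "\<dots> =
    do {T \<leftarrow> subset_pmf k n; b \<leftarrow> index_pmf k n; C \<leftarrow> index_pmf k n; g \<leftarrow> ?Q;
        return_pmf ((fst \<circ> g)(n := T), C, b)}"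
    unfolding B by (rule bind_commute_pmf)
  also have "\<dots> =
    do {T \<leftarrow> subset_pmf k n; g \<leftarrow> ?Q; C \<leftarrow> index_pmf k n; b \<leftarrow> index_pmf k n;
        return_pmf ((fst \<circ> g)(n := T), C, b)}"
    by (intro bind_pmf_cong refl bind_pmf_reverse3)
  also have "\<dots> = pair_pmf (past_pmf k n) (pair_pmf (index_pmf k n) (index_pmf k n))"
    by (simp add: past_pmf pair_pmf_def bind_assoc_pmf bind_return_pmf)
  finally show ?thesis .
qed

text \<open>The induction passes to parents one level up, so \<open>n\<close> must vary. The past is
  carried along because the step needs parent indices independent of the subset that is read next.
  The bound \<open>n + c \<le> N\<close> survives since \<open>c div 2 + 1 \<le> c\<close> for
  \<open>c \<ge> 2\<close>.\<close>

lemma block_pair_law: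
  assumes "1 \<le> c" "n + c \<le> N"
  shows "map_pmf (\<lambda>\<omega>. (past n \<omega>, block \<omega> n c, block \<omega> n (Suc c))) (finite_rha_pmf k N) =
    pair_pmf (past_pmf k n) (pair_pmf (index_pmf k n) (index_pmf k n))"
  using assms
proof (induction c arbitrary: n rule: less_induct)
  case (less c)
  let ?I = "index_pmf k (Suc n)"
  show ?case
  proof (cases "c = 1")
    case True
    have "block \<omega> n c = snd (\<omega> n)"
      "block \<omega> n (Suc c) = fst (lex_nth (fst (\<omega> (Suc n))) (snd (\<omega> (Suc n))))" for \<omega>
      using True by (simp_all add: block.simps Let_def)
    then show ?thesis
      using less.prems True first_blocks_law[of n]
      by (subst map_finite_rha_pmf_mono[where M = "Suc n"]) (auto simp: past_def fun_eq_iff)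
  next
    case False
    let ?c = "c div 2"
    have IH: "map_pmf (\<lambda>\<omega>. (past (Suc n) \<omega>, block \<omega> (Suc n) ?c, block \<omega> (Suc n) (Suc ?c)))
        (finite_rha_pmf k N) = pair_pmf (past_pmf k (Suc n)) (pair_pmf ?I ?I)"
      using less.prems False by (intro less.IH) auto
    have step: "map_pmf (\<lambda>\<omega>. (past n \<omega>,
          h (fst (\<omega> (Suc n))) (block \<omega> (Suc n) ?c, block \<omega> (Suc n) (Suc ?c)))) (finite_rha_pmf k N) =
        pair_pmf (past_pmf k n) (do {T \<leftarrow> subset_pmf k (Suc n); map_pmf (h T) (pair_pmf ?I ?I)})"
      for h :: "_ \<Rightarrow> _ \<Rightarrow> nat \<times> nat"
    proof -
      have "(past (Suc n) \<omega>)(Suc n := {}) = past n \<omega>" "past (Suc n) \<omega> (Suc n) = fst (\<omega> (Suc n))" for \<omega>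
        by (auto simp: past_def fun_eq_iff)
      then show ?thesis
        unfolding past_pmf_step[symmetric] IH[symmetric] pmf.map_comp
        by (simp add: o_def)
    qed
    show ?thesis
    proof (cases "even c")
      case True
      have "(block \<omega> n c, block \<omega> n (Suc c)) =
          lex_nth (fst (\<omega> (Suc n))) (block \<omega> (Suc n) ?c)" for \<omega>
        using True False less.prems
        by (simp add: block.simps[of \<omega> n c] block.simps[of \<omega> n "Suc c"] Let_def)
      \<comment> \<open>Siblings share the parent \<open>?c\<close>, so the index of the second
        parent is integrated out.\<close>
      moreover have "map_pmf (\<lambda>u. lex_nth T (fst u)) (pair_pmf ?I ?I) = map_pmf (lex_nth T) ?I" for T
      proof -
        have "map_pmf (lex_nth T) (map_pmf fst (pair_pmf ?I ?I)) = map_pmf (lex_nth T) ?I"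
          by (simp only: map_fst_pair_pmf)
        then show ?thesis by (simp only: pmf.map_comp o_def)
      qed
      ultimately show ?thesis
        using step[of "\<lambda>T u. lex_nth T (fst u)"] sibling_law[of n]
        by (simp only: fst_conv)
    next
      case odd: False
      then have "(block \<omega> n c, block \<omega> n (Suc c)) =
          (\<lambda>(a, b). (snd (lex_nth (fst (\<omega> (Suc n))) a), fst (lex_nth (fst (\<omega> (Suc n))) b)))
            (block \<omega> (Suc n) ?c, block \<omega> (Suc n) (Suc ?c))" for \<omega>
        using False less.prems
        by (simp add: block.simps[of \<omega> n c] block.simps[of \<omega> n "Suc c"] Let_def)
      then show ?thesis
        using step[of "\<lambda>T (a, b). (snd (lex_nth T a), fst (lex_nth T b))"]
          cousin_law[of n]
        by (simp only:)
    qed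
  qed
qed

end

section \<open>Reduction to finitely many levels\<close>

text \<open>Both sides give a box the product of its side masses, which determines a product
  measure. The restriction reconciles the value \<open>d\<close> off \<open>J\<close> in
  \<open>Pi_pmf\<close> with \<open>undefined\<close> in the product space.\<close>

lemma distr_restrict_Pi_pmf:
  assumes "finite J"
  shows "distr (measure_pmf (Pi_pmf J d p)) (\<Pi>\<^sub>M i\<in>J. measure_pmf (p i)) (\<lambda>f. restrict f J) =
    (\<Pi>\<^sub>M i\<in>J. measure_pmf (p i))"
proof -
  interpret product_prob_space "\<lambda>i. measure_pmf (p i)" UNIV
    by unfold_locales
  show ?thesis
  proof (rule PiM_eqI)
    fix A :: "'a \<Rightarrow> 'b set"
    have "(\<lambda>f. restrict f J) -` Pi\<^sub>E J A = Pi J A"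
      by (auto simp: PiE_def Pi_def)
    moreover have "Pi\<^sub>E J A \<in> sets (\<Pi>\<^sub>M i\<in>J. measure_pmf (p i))"
      using assms by (intro sets_PiM_I_finite) auto
    ultimately show "emeasure (distr (measure_pmf (Pi_pmf J d p)) (\<Pi>\<^sub>M i\<in>J. measure_pmf (p i))
        (\<lambda>f. restrict f J)) (Pi\<^sub>E J A) = (\<Prod>i\<in>J. emeasure (measure_pmf (p i)) (A i))"
      using assms
      by (subst emeasure_distr)
         (auto simp: measure_pmf.emeasure_eq_measure measure_Pi_pmf_Pi prod_ennreal space_PiM)
  qed (use assms in auto)
qed

text \<open>A level takes values in an uncountable type, so discrete measurability of functions of
  several levels is not automatic; they are assembled through countable-valued pieces.\<close>

lemma measurable_count_space_binary:
  fixes u :: "'m \<Rightarrow> 'a :: countable" and h :: "'a \<Rightarrow> 'b \<Rightarrow> 'c"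
  assumes "u \<in> M \<rightarrow>\<^sub>M count_space UNIV" "v \<in> M \<rightarrow>\<^sub>M count_space UNIV"
  shows "(\<lambda>z. h (u z) (v z)) \<in> M \<rightarrow>\<^sub>M count_space UNIV"
  by (rule measurable_compose_countable[OF _ assms(1)], rule measurable_compose[OF assms(2)]) simp

lemma measurable_map_count_space:
  fixes f :: "'l \<Rightarrow> 'm \<Rightarrow> 'a :: countable"
  assumes "\<And>l. f l \<in> M \<rightarrow>\<^sub>M count_space UNIV"
  shows "(\<lambda>z. map (\<lambda>l. f l z) ls) \<in> M \<rightarrow>\<^sub>M count_space UNIV"
proof (induction ls)
  case (Cons l ls)
  then show ?case
    using measurable_count_space_binary[OF assms[of l], where h = "(#)"] by simp
qed simp

context
  fixes M :: "'m measure" and w :: "'m \<Rightarrow> nat \<Rightarrow> (nat \<times> nat) set \<times> nat"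
  assumes w: "\<And>l. (\<lambda>z. w z l) \<in> M \<rightarrow>\<^sub>M count_space UNIV"
begin

lemma measurable_rha_Y:
  "(\<lambda>z. rha_Y (\<lambda>l. fst (w z l)) n j) \<in> M \<rightarrow>\<^sub>M count_space UNIV"
proof (induction n arbitrary: j)
  case (Suc n)
  let ?p = "\<lambda>z. lex_nth (fst (w z (Suc n))) j"
  let ?Y = "\<lambda>q z. rha_Y (\<lambda>l. fst (w z l)) n (fst q) @ rha_Y (\<lambda>l. fst (w z l)) n (snd q)"
  have p: "?p \<in> M \<rightarrow>\<^sub>M count_space UNIV"
    by (rule measurable_compose[OF w]) simp
  \<comment> \<open>The child indices are frozen at \<open>q\<close> first; only countably many
    values can then be substituted.\<close>
  have "?Y q \<in> M \<rightarrow>\<^sub>M count_space UNIV" for q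
    by (rule measurable_count_space_binary[OF Suc.IH Suc.IH, where h = "(@)"])
  from measurable_compose_countable[where f = ?Y, OF this p]
  have "(\<lambda>z. ?Y (?p z) z) \<in> M \<rightarrow>\<^sub>M count_space UNIV" .
  then show ?case by (simp add: Let_def)
qed simp

lemma measurable_rha_X:
  "(\<lambda>z. rha_X (w z) i) \<in> M \<rightarrow>\<^sub>M count_space UNIV"
proof -
  have snd_w: "(\<lambda>z. snd (w z n)) \<in> M \<rightarrow>\<^sub>M count_space UNIV" for n
    by (rule measurable_compose[OF w]) simp
  have "(\<lambda>z. rha_Y (\<lambda>l. fst (w z l)) n (snd (w z n))) \<in> M \<rightarrow>\<^sub>M count_space UNIV" for n
    by (rule measurable_compose_countable[OF measurable_rha_Y snd_w])
  then have "(\<lambda>z. map (\<lambda>n. rha_Y (\<lambda>l. fst (w z l)) n (snd (w z n))) [0..<Suc i]) \<in> M \<rightarrow>\<^sub>M count_space UNIV"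
    by (rule measurable_map_count_space)
  then show ?thesis
    unfolding rha_X_def by (rule measurable_compose) simp
qed

end

text \<open>The window ends at or before position \<open>N\<close>, and the symbol at a position
  reads no level beyond that position. The infinite product and the finite law both restrict to the
  same product over \<open>{..N}\<close>.\<close>

lemma rha_prob_eq_finite:
  assumes "i + length x \<le> Suc N"
  shows "rha_prob k i x = measure_pmf.prob (finite_rha_pmf k N) {\<omega>. map (rha_X \<omega>) [i..<i + length x] = x}"
proof -
  let ?Q = "\<lambda>\<omega>. map (rha_X \<omega>) [i..<i + length x] = x"
  let ?ext = "\<lambda>f l. if l \<le> N then f l else ({}, 0)"
  let ?PJ = "\<Pi>\<^sub>M n\<in>{..N}. measure_pmf (rha_level k n)"
  let ?E = "{f \<in> space ?PJ. ?Q (?ext f)}"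
  interpret product_prob_space "\<lambda>n. measure_pmf (rha_level k n)" UNIV
    by unfold_locales
  have "(\<lambda>f. ?ext f l) \<in> ?PJ \<rightarrow>\<^sub>M count_space UNIV" for l
  proof (cases "l \<le> N")
    case True
    then have "(\<lambda>f. f l) \<in> ?PJ \<rightarrow>\<^sub>M measure_pmf (rha_level k l)"
      by (intro measurable_component_singleton) simp
    then show ?thesis using True by simp
  qed simp
  then have "(\<lambda>f. map (\<lambda>t. rha_X (?ext f) t) [i..<i + length x]) \<in> ?PJ \<rightarrow>\<^sub>M count_space UNIV"
    by (intro measurable_map_count_space measurable_rha_X)
  then have E: "?E \<in> sets ?PJ"
    by (rule measurable_sets_Collect[where P = "\<lambda>y. y = x"]) simp
  have Q: "?Q (?ext (restrict \<omega> {..N})) = ?Q \<omega>" for \<omega>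
  proof -
    have "map (rha_X (?ext (restrict \<omega> {..N}))) [i..<i + length x] = map (rha_X \<omega>) [i..<i + length x]"
      using assms by (intro map_cong refl rha_X_cong) auto
    then show ?thesis by (simp only:)
  qed
  have restrict: "restrict \<omega> {..N} \<in> space ?PJ" for \<omega>
    by (simp add: space_PiM)
  have meas: "(\<lambda>\<omega>. restrict \<omega> {..N}) \<in> rha_space k \<rightarrow>\<^sub>M ?PJ"
    unfolding rha_space_def by (intro measurable_restrict_subset) simp
  have "{\<omega> \<in> space (rha_space k). ?Q \<omega>} = (\<lambda>\<omega>. restrict \<omega> {..N}) -` ?E \<inter> space (rha_space k)"
    using restrict Q by auto
  then have "rha_prob k i x = measure (distr (rha_space k) ?PJ (\<lambda>\<omega>. restrict \<omega> {..N})) ?E"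
    unfolding rha_prob_def using measure_distr[OF meas E] by simp
  also have "\<dots> = measure ?PJ ?E"
    unfolding rha_space_def by (subst distr_PiM_restrict_finite) auto
  also have "\<dots> = measure (distr (finite_rha_pmf k N) ?PJ (\<lambda>\<omega>. restrict \<omega> {..N})) ?E"
    unfolding finite_rha_pmf_def by (simp only: distr_restrict_Pi_pmf[OF finite_atMost])
  also have "\<dots> = measure_pmf.prob (finite_rha_pmf k N) ((\<lambda>\<omega>. restrict \<omega> {..N}) -` ?E)"
    using restrict by (subst measure_distr) (auto simp: E)
  also have "(\<lambda>\<omega>. restrict \<omega> {..N}) -` ?E = {\<omega>. ?Q \<omega>}"
    using restrict Q by auto
  finally show ?thesis .
qed

section \<open>Periodicity and Cesaro means\<close>

text \<open>The window event depends on the past and two block indices, whose joint law does not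
  involve \<open>c\<close>; compare with \<open>c = 1\<close>.\<close>

lemma rha_prob_periodic:
  assumes kpos: "\<And>n. 0 < k n" and kgrowth: "\<And>n. k (Suc n) \<le> (k n)\<^sup>2"
    and "length x \<le> 2 ^ n" "1 \<le> c" "j < 2 ^ n"
  shows "rha_prob k (c * 2 ^ n + j) x = rha_prob k (2 ^ n + j) x"
proof -
  let ?P = "\<lambda>(S, a, b). map ((!) (rha_Y S n a @ rha_Y S n b)) [j..<j + length x] = x"
  have "rha_prob k (c * 2 ^ n + j) x =
    measure_pmf.prob (pair_pmf (past_pmf k n) (pair_pmf (index_pmf k n) (index_pmf k n))) {v. ?P v}"
    if c: "1 \<le> c" for c
  proof -
    \<comment> \<open>The first two summands serve \<open>block_pair_law\<close>, the rest covers
      the window.\<close>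
    define N where "N = n + c + (c * 2 ^ n + j + length x)"
    have "rha_Y (\<lambda>l. fst (\<omega> l)) n a = rha_Y (past n \<omega>) n a" for \<omega> a
      by (rule rha_Y_cong) (simp add: past_def)
    then have "map (rha_X \<omega>) [c * 2 ^ n + j..<c * 2 ^ n + j + length x] = x \<longleftrightarrow>
        ?P (past n \<omega>, block \<omega> n c, block \<omega> n (Suc c))" for \<omega>
      using rha_X_window[OF c assms(5,3)] by simp
    then have "rha_prob k (c * 2 ^ n + j) x = measure_pmf.prob (finite_rha_pmf k N)
        ((\<lambda>\<omega>. (past n \<omega>, block \<omega> n c, block \<omega> n (Suc c))) -` {v. ?P v})"
      by (subst rha_prob_eq_finite[where N = N]) (auto simp: N_def vimage_def)
    also have "\<dots> = measure_pmf.prob (map_pmf (\<lambda>\<omega>. (past n \<omega>, block \<omega> n c, block \<omega> n (Suc c)))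
        (finite_rha_pmf k N)) {v. ?P v}"
      by (simp only: measure_map_pmf)
    also have "map_pmf (\<lambda>\<omega>. (past n \<omega>, block \<omega> n c, block \<omega> n (Suc c))) (finite_rha_pmf k N) =
        pair_pmf (past_pmf k n) (pair_pmf (index_pmf k n) (index_pmf k n))"
      by (rule block_pair_law[of k, OF kpos kgrowth c]) (simp add: N_def)
    finally show ?thesis .
  qed
  from this[OF assms(4)] this[of 1] show ?thesis by simp
qed

text \<open>The partial sums centred by \<open>N * \<mu>\<close> are eventually periodic, hence
  bounded, and vanish after division by \<open>N\<close>.\<close>

lemma cesaro_periodic:
  fixes f :: "nat \<Rightarrow> real"
  assumes "0 < p" and per: "\<And>i. p \<le> i \<Longrightarrow> f (i + p) = f i"
  shows "(\<lambda>N. (\<Sum>i=1..N. f i) / real N) \<longlonglongrightarrow> (\<Sum>j<p. f (p + j)) / real p"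
proof -
  define \<mu> where "\<mu> = (\<Sum>j<p. f (p + j)) / real p"
  define g where "g N = (\<Sum>i=1..N. f i) - real N * \<mu>" for N
  have window: "(\<Sum>j<p. f (N + j)) = p * \<mu>" if "p \<le> N" for N
    using that
  proof (induction N rule: dec_induct)
    case base
    show ?case using assms(1) by (simp add: \<mu>_def)
  next
    case (step N)
    have "f N + (\<Sum>j<p. f (Suc N + j)) = (\<Sum>j<Suc p. f (N + j))"
      by (simp add: sum.lessThan_Suc_shift del: sum.lessThan_Suc)
    also have "\<dots> = (\<Sum>j<p. f (N + j)) + f N"
      using per[of N] step.hyps by simp
    finally show ?case using step.IH by simp
  qed
  have g_per: "g (N + p) = g N" if "p \<le> N" for N
  proof -
    have "(\<Sum>i=1..N + p. f i) = (\<Sum>i=1..N. f i) + (\<Sum>i=Suc N..N + p. f i)"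
      by (rule sum.ub_add_nat[of 1 N f p, simplified Suc_eq_plus1[symmetric]]) simp
    also have "(\<Sum>i=Suc N..N + p. f i) = (\<Sum>j<p. f (Suc N + j))"
      by (rule sum.reindex_bij_witness[of _ "\<lambda>j. Suc N + j" "\<lambda>i. i - Suc N"]) auto
    finally show ?thesis
      using window[of "Suc N"] that by (simp add: g_def algebra_simps)
  qed
  \<comment> \<open>Periodicity starts at \<open>p\<close>, so arguments from \<open>2 * p\<close>
    on can be lowered by \<open>p\<close>; below that, each value is a summand of the bound.\<close>
  have bound: "\<bar>g N\<bar> \<le> (\<Sum>i<2 * p. \<bar>g i\<bar>)" for N
  proof (induction N rule: less_induct)
    case (less N)
    show ?case
    proof (cases "N < 2 * p")
      case True
      then show ?thesis by (intro member_le_sum) auto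
    next
      case False
      then show ?thesis
        using less.IH[of "N - p"] g_per[of "N - p"] assms(1) by simp
    qed
  qed
  have "(\<lambda>N. g N / real N) \<longlonglongrightarrow> 0"
  proof (rule Lim_null_comparison)
    show "\<forall>\<^sub>F N in sequentially. norm (g N / real N) \<le> (\<Sum>i<2 * p. \<bar>g i\<bar>) / real N"
      using bound by (auto intro!: always_eventually divide_right_mono)
    show "(\<lambda>N. (\<Sum>i<2 * p. \<bar>g i\<bar>) / real N) \<longlonglongrightarrow> 0"
      by (rule lim_const_over_n)
  qed
  then have "(\<lambda>N. g N / real N + \<mu>) \<longlonglongrightarrow> 0 + \<mu>"
    by (intro tendsto_intros)
  moreover have "\<forall>\<^sub>F N in sequentially. g N / real N + \<mu> = (\<Sum>i=1..N. f i) / real N"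
    using eventually_gt_at_top[of 0] by eventually_elim (simp add: g_def field_simps)
  ultimately show ?thesis
    unfolding \<mu>_def by (simp add: tendsto_cong)
qed

theorem theorem4:
  fixes k :: "nat \<Rightarrow> nat"
  assumes kpos: "\<And>n. 0 < k n"
    and kgrowth: "\<And>n. n \<ge> 1 \<Longrightarrow> k (n - 1) \<le> k n \<and> k n \<le> (k (n - 1))^2"
  shows "\<forall>m \<ge> 1. \<forall>x :: nat list. length x = m \<and> set x \<subseteq> {1..k 0} \<longrightarrow>
           (\<exists>\<mu>. (\<lambda>N. (\<Sum>i=1..N. rha_prob k i x) / real N) \<longlonglongrightarrow> \<mu> \<and>
                (\<forall>n c. m \<le> 2^n \<and> c \<ge> 1 \<longrightarrow>
                   \<mu> = (\<Sum>j<2^n. rha_prob k (c * 2^n + j) x) / 2^n))"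
proof (intro allI impI, elim conjE)
  fix m :: nat and x :: "nat list"
  assume m: "length x = m"
  let ?\<mu> = "\<lambda>n. (\<Sum>j<2^n. rha_prob k (2^n + j) x) / 2^n"
  have periodic: "rha_prob k (c * 2 ^ n + j) x = rha_prob k (2 ^ n + j) x"
    if "m \<le> 2 ^ n" "1 \<le> c" "j < 2 ^ n" for n c j
    using that m kgrowth[of "Suc n" for n] by (intro rha_prob_periodic kpos) auto
  have lim: "(\<lambda>N. (\<Sum>i=1..N. rha_prob k i x) / real N) \<longlonglongrightarrow> ?\<mu> n" if n: "m \<le> 2 ^ n" for n
  proof -
    have "rha_prob k (i + 2 ^ n) x = rha_prob k i x" if "2 ^ n \<le> i" for i
    proof -
      have c: "1 \<le> i div 2 ^ n" using that by (simp add: Suc_le_eq div_greater_zero_iff)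
      have i: "i div 2 ^ n * 2 ^ n + i mod 2 ^ n = i" by (rule div_mult_mod_eq)
      then have i': "Suc (i div 2 ^ n) * 2 ^ n + i mod 2 ^ n = i + 2 ^ n" by simp
      show ?thesis
        using periodic[OF n c, of "i mod 2 ^ n"] periodic[OF n, of "Suc (i div 2 ^ n)" "i mod 2 ^ n"]
        unfolding i i' by simp
    qed
    then show ?thesis
      using cesaro_periodic[of "2 ^ n" "\<lambda>i. rha_prob k i x"] by simp
  qed
  \<comment> \<open>Level \<open>m\<close> serves as a reference that fixes the limit before
    \<open>n\<close> is chosen; the means over other periods are limits of the same sequence, hence
    equal to it.\<close>
  have "m \<le> 2 ^ m" using less_exp[of m] by simp
  note lim_m = lim[OF this]
  have "?\<mu> m = (\<Sum>j<2^n. rha_prob k (c * 2^n + j) x) / 2^n" if "m \<le> 2 ^ n" "1 \<le> c" for n c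
    using LIMSEQ_unique[OF lim_m lim[OF that(1)]] periodic[OF that] by simp
  with lim_m show "\<exists>\<mu>. (\<lambda>N. (\<Sum>i=1..N. rha_prob k i x) / real N) \<longlonglongrightarrow> \<mu> \<and>
      (\<forall>n c. m \<le> 2^n \<and> c \<ge> 1 \<longrightarrow> \<mu> = (\<Sum>j<2^n. rha_prob k (c * 2^n + j) x) / 2^n)"
    by blast
qed

end
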